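(* Consider a capacity achieving PMF $\mathbf{p}^*$ and some input PMF $\tilde{\mathbf{p}}$. If $\tilde{p}_i=0$ whenever $p_i^*=0$, then the corresponding operating points $(\tilde{E},\tilde{I})$ and $(E^*,I^* )$, where $\tilde{I}=\mathcal{I}(\tilde{\mathbf{p}})$ and $I^*=\mathcal{I}(\mathbf{p}^* )$, relate as follows: $$\tilde{E}=\mathbf{w}^T\tilde{\mathbf{p}},\qquad E^*=\mathbf{w}^T\mathbf{p}^*,$$ $$\tilde{I}=I^*+\mathcal{C}'(E^* )(\tilde{E}-E^* )-D(\tilde{q}\,\Vert\,q^* ),$$ where $\tilde{q}=\sum_i\tilde{p}_ih_i$ and $q^*=\sum_i p_i^*h_i$ are the output densities that correspond to $\tilde{\mathbf{p}}$ and $\mathbf{p}^*$, respectively, and $\mathcal{C}'(E)$ is the derivative of the capacity curve $\mathcal{C}(E)$ with respect to $E$.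
   Context: Channel: a discrete-time memoryless channel with additive noise $Y=X+Z$. The input $X$ takes values in a finite signal constellation $\mathcal{X}=\{x_1,\dots,x_m\}\subset\mathbb{C}$ with $|\mathcal{X}|=m$; the noise $Z$ takes values in $\mathbb{C}$ and is distributed according to a density $h$; conditioned on $X=x_i$, the output $Y$ has density $h_i(y)=h(y-x_i)$. Put $w_i=|x_i|^2$ and $\mathbf{w}=(w_1,\dots,w_m)^T$. For an input PMF $\mathbf{p}=(p_1,\dots,p_m)^T$ the mutual information between $X$ and $Y$ is $$\mathcal{I}(\mathbf{p})=-\int_{\mathbb{C}}\Bigl(\sum_i p_ih_i(y)\Bigr)\log\Bigl(\sum_i p_ih_i(y)\Bigr)dy+\sum_i p_i\int_{\mathbb{C}}h_i(y)\log h_i(y)\,dy.$$ Capacity curve: $\mathcal{C}(E)$ is the maximum of $\mathcal{I}(\mathbf{p})$ over all PMFs $\mathbf{p}$ on $\mathcal{X}$ with $\mathbf{w}^T\mathbf{p}\le E$. A PMF $\mathbf{p}^*$ is capacity achieving if it attains this maximum for $E=E^*=\mathbf{w}^T\mathbf{p}^*$. The operating point of a PMF $\mathbf{p}$ is $(\mathbf{w}^T\mathbf{p},\mathcal{I}(\mathbf{p}))$. $D(q\Vert q')=\int_{\mathbb{C}}q(y)\log\frac{q(y)}{q'(y)}\,dy$ is the Kullback-Leibler distance between densities. *)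

theory Defs
  imports "HOL-Probability.Probability"
begin

text \<open>
  A constellation of \<open>m\<close> points is an injective function \<open>x\<close> from a finite index type with
  \<open>m = CARD('m)\<close> elements into the complex numbers; vectors indexed by the constellation points
  have type \<open>real ^ 'm\<close>. Integration over the complex plane is with respect to \<open>lborel\<close>, and
  the base \<open>b > 1\<close> of all logarithms is a parameter. Since multiplication by \<open>0\<close> yields \<open>0\<close>,
  the convention \<open>0 log 0 = 0\<close> holds automatically.
\<close>

definition noise_density :: "(complex \<Rightarrow> real) \<Rightarrow> bool" where
  "noise_density h \<longleftrightarrow>
     h \<in> borel_measurable borel \<and> (\<forall>z. 0 \<le> h z) \<and>
     integrable lborel h \<and> (LINT z|lborel. h z) = 1"

definition input_pmf :: "real ^ 'm \<Rightarrow> bool" where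
  "input_pmf p \<longleftrightarrow> (\<forall>i. 0 \<le> p $ i) \<and> (\<Sum>i\<in>UNIV. p $ i) = 1"

definition cond_density :: "(complex \<Rightarrow> real) \<Rightarrow> ('m \<Rightarrow> complex) \<Rightarrow> 'm \<Rightarrow> complex \<Rightarrow> real" where
  "cond_density h x i y = h (y - x i)"

definition output_density ::
    "(complex \<Rightarrow> real) \<Rightarrow> ('m::finite \<Rightarrow> complex) \<Rightarrow> real ^ 'm \<Rightarrow> complex \<Rightarrow> real" where
  "output_density h x p y = (\<Sum>i\<in>UNIV. p $ i * cond_density h x i y)"

definition weights :: "('m::finite \<Rightarrow> complex) \<Rightarrow> real ^ 'm" where
  "weights x = (\<chi> i. (cmod (x i))\<^sup>2)"

definition mutual_info ::
    "real \<Rightarrow> (complex \<Rightarrow> real) \<Rightarrow> ('m::finite \<Rightarrow> complex) \<Rightarrow> real ^ 'm \<Rightarrow> real" where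
  "mutual_info b h x p =
     - (LINT y|lborel. output_density h x p y * log b (output_density h x p y))
     + (\<Sum>i\<in>UNIV. p $ i * (LINT y|lborel. cond_density h x i y * log b (cond_density h x i y)))"

definition feasible_pmfs :: "('m::finite \<Rightarrow> complex) \<Rightarrow> real \<Rightarrow> (real ^ 'm) set" where
  "feasible_pmfs x E = {p. input_pmf p \<and> weights x \<bullet> p \<le> E}"

text \<open>
  The capacity curve is meaningful only for \<open>E\<close> not below the least weight; for smaller \<open>E\<close> no
  PMF is feasible and the value is arbitrary.
\<close>

definition capacity ::
    "real \<Rightarrow> (complex \<Rightarrow> real) \<Rightarrow> ('m::finite \<Rightarrow> complex) \<Rightarrow> real \<Rightarrow> real" where
  "capacity b h x E = (GREATEST c. c \<in> mutual_info b h x ` feasible_pmfs x E)"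

definition capacity_achieving ::
    "real \<Rightarrow> (complex \<Rightarrow> real) \<Rightarrow> ('m::finite \<Rightarrow> complex) \<Rightarrow> real ^ 'm \<Rightarrow> bool" where
  "capacity_achieving b h x p \<longleftrightarrow>
     input_pmf p \<and>
     (\<forall>p' \<in> feasible_pmfs x (weights x \<bullet> p). mutual_info b h x p' \<le> mutual_info b h x p)"

definition kl_dist :: "real \<Rightarrow> (complex \<Rightarrow> real) \<Rightarrow> (complex \<Rightarrow> real) \<Rightarrow> real" where
  "kl_dist b q q' = (LINT y|lborel. q y * log b (q y / q' y))"

text \<open>
  The library's divergence takes measures rather than densities, in the opposite order.
\<close>

lemma kl_dist_eq_KL_divergence:
  assumes "1 < b"
    and "q \<in> borel_measurable borel" "\<And>y. 0 \<le> q y"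
    and "q' \<in> borel_measurable borel" "\<And>y. 0 \<le> q' y"
    and "\<And>y. q' y = 0 \<Longrightarrow> q y = 0"
  shows "kl_dist b q q' = KL_divergence b (density lborel q') (density lborel q)"
  unfolding kl_dist_def
  by (rule lborel.KL_density_density[symmetric]) (use assms in auto)

lemma capacity_achieving_imp_capacity_eq:
  assumes "capacity_achieving b h x p"
  shows "capacity b h x (weights x \<bullet> p) = mutual_info b h x p"
  unfolding capacity_def
  by (rule Greatest_equality)
     (use assms in \<open>auto simp: capacity_achieving_def feasible_pmfs_def\<close>)

end

theory Submission
  imports Defs "HOL-Real_Asymp.Real_Asymp"
begin

text \<open>
  For \<open>r\<close> supported where \<open>p\<close> is, \<open>I(r) = L\<^sub>p(r) - D(q\<^sub>r || q\<^sub>p)\<close> exactly, with \<open>L\<^sub>p\<close> linear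
  and \<open>L\<^sub>p(p) = I(p)\<close>. On the line \<open>p + t (r - p)\<close>, which consists of PMFs for small \<open>t\<close> of both
  signs, the divergence is \<open>O(t\<^sup>2)\<close>. If \<open>p\<close> is capacity achieving and \<open>r\<close> has another energy,
  the points of this line bound the capacity curve near \<open>E*\<close> from below by an affine function up to
  a quadratic error that vanishes at \<open>E*\<close>; concavity of the curve at \<open>E*\<close> turns this into a
  two-sided bound, so the curve is differentiable there with the slope of \<open>L\<^sub>p\<close>. If \<open>r\<close> has
  the same energy, optimality of \<open>p\<close> for both signs of \<open>t\<close> forces \<open>L\<^sub>p(r) = I(p)\<close>.
\<close>

section \<open>The function \<open>u log u\<close> and a derivative criterion\<close>

text \<open>The left side is the tangent of \<open>u * log b u\<close> at \<open>v\<close>. For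
  positive \<open>u\<close> the bound is \<open>ln z \<le> z - 1\<close> at
  \<open>z = v / u\<close>, multiplied by \<open>u\<close>.\<close>

lemma xlog_ge_tangent:
  fixes b u v :: real
  assumes "1 < b" "0 \<le> u" "0 < v"
  shows "u * log b v + (u - v) / ln b \<le> u * log b u"
proof (cases "u = 0")
  case True
  with assms show ?thesis by simp
next
  case False
  with assms have u: "0 < u" by simp
  have "ln v - ln u \<le> v / u - 1"
    using ln_le_minus_one[of "v / u"] u assms by (simp add: ln_div)
  then have "u * (ln v - ln u) \<le> u * (v / u - 1)"
    using u by (intro mult_left_mono) auto
  then have "u * ln v + (u - v) \<le> u * ln u"
    using u by (simp add: algebra_simps)
  then have "(u * ln v + (u - v)) / ln b \<le> u * ln u / ln b"
    using assms by (intro divide_right_mono) auto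
  then show ?thesis by (simp add: log_def add_divide_distrib)
qed

text \<open>Averaging the tangent bounds at the mean \<open>w\<close> cancels their linear terms. If
  \<open>w = 0\<close> there is no tangent, but then both points are 0.\<close>

lemma convex_on_xlog:
  fixes b :: real
  assumes "1 < b"
  shows "convex_on {0..} (\<lambda>u. u * log b u)"
proof (rule convex_onI)
  fix t u v :: real
  assume t: "0 < t" "t < 1" and uv: "u \<in> {0..}" "v \<in> {0..}"
  define w where "w = (1 - t) * u + t * v"
  show "((1 - t) *\<^sub>R u + t *\<^sub>R v) * log b ((1 - t) *\<^sub>R u + t *\<^sub>R v)
      \<le> (1 - t) * (u * log b u) + t * (v * log b v)"
  proof (cases "w = 0")
    case True
    then have "u = 0" "v = 0"
      using t uv by (simp_all add: w_def add_nonneg_eq_0_iff)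
    then show ?thesis by simp
  next
    case False
    then have w: "0 < w"
      using t uv by (simp add: w_def order_less_le)
    have "(1 - t) * (u * log b w + (u - w) / ln b) + t * (v * log b w + (v - w) / ln b)
        \<le> (1 - t) * (u * log b u) + t * (v * log b v)"
      using xlog_ge_tangent[OF assms _ w] t uv by (intro add_mono mult_left_mono) auto
    also have "(1 - t) * (u * log b w + (u - w) / ln b) + t * (v * log b w + (v - w) / ln b)
        = w * log b w + ((1 - t) * u + t * v - w) / ln b"
      by (simp add: w_def field_simps add_divide_distrib diff_divide_distrib)
    finally show ?thesis by (simp add: w_def)
  qed
qed simp

text \<open>Only the point 0 needs a limit: \<open>u * ln u\<close> tends to 0 there, which is also
  the value of the product at 0.\<close>

lemma continuous_on_xlog:
  fixes b :: real
  assumes "1 < b"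
  shows "continuous_on {0..} (\<lambda>u. u * log b u)"
proof -
  have "continuous (at u within {0..}) (\<lambda>u. u * log b u)" if u: "0 \<le> u" for u :: real
  proof (cases "u = 0")
    case True
    have "((\<lambda>u::real. u * ln u) \<longlongrightarrow> 0) (at_right 0)"
      by real_asymp
    then have "((\<lambda>u. u * ln u / ln b) \<longlongrightarrow> 0 / ln b) (at_right 0)"
      using assms by (intro tendsto_divide) auto
    then have "((\<lambda>u. u * log b u) \<longlongrightarrow> 0) (at_right 0)"
      by (simp add: log_def)
    then show ?thesis
      using True by (simp add: continuous_within at_within_Ici_at_right)
  next
    case False
    have "ln b \<noteq> 0"
      using assms by simp
    then have "isCont (\<lambda>u. u * (ln u / ln b)) u"
      by (intro isCont_mult isCont_divide isCont_ln continuous_ident continuous_const False)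
    then show ?thesis
      unfolding log_def by (rule continuous_at_imp_continuous_at_within)
  qed
  then show ?thesis by (simp add: continuous_on_eq_continuous_within)
qed

text \<open>Dividing by \<open>s\<close> leaves an error of at most \<open>M * \<bar>s\<bar>\<close>
  between the difference quotient and \<open>D\<close>.\<close>

lemma has_real_derivative_of_quadratic_bound:
  fixes g :: "real \<Rightarrow> real"
  assumes "\<forall>\<^sub>F s in nhds 0. \<bar>g (a + s) - g a - s * D\<bar> \<le> M * s\<^sup>2"
  shows "(g has_real_derivative D) (at a)"
  unfolding DERIV_def
proof -
  have "\<forall>\<^sub>F s in at 0. norm ((g (a + s) - g a) / s - D) \<le> M * \<bar>s\<bar>"
  proof -
    have "\<forall>\<^sub>F s in at 0. \<bar>g (a + s) - g a - s * D\<bar> \<le> M * s\<^sup>2 \<and> s \<noteq> (0::real)"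
      using assms by (auto simp: eventually_at_filter elim: eventually_mono)
    then show ?thesis
    proof eventually_elim
      case (elim s)
      then have "\<bar>(g (a + s) - g a - s * D) / s\<bar> \<le> M * s\<^sup>2 / \<bar>s\<bar>"
        by (simp add: divide_right_mono)
      moreover have "(g (a + s) - g a - s * D) / s = (g (a + s) - g a) / s - D"
        using elim by (simp add: field_simps)
      moreover have "M * s\<^sup>2 / \<bar>s\<bar> = M * \<bar>s\<bar>"
        using elim by (simp add: power2_eq_square abs_if field_simps)
      ultimately show ?case by simp
    qed
  qed
  moreover have "((\<lambda>s. M * \<bar>s\<bar>) \<longlongrightarrow> 0) (at 0)"
    by (auto intro!: tendsto_eq_intros)
  ultimately have "((\<lambda>s. (g (a + s) - g a) / s - D) \<longlongrightarrow> 0) (at 0)"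
    by (rule Lim_null_comparison)
  then show "(\<lambda>s. (g (a + s) - g a) / s) \<midarrow>0\<rightarrow> D"
    by (simp add: LIM_zero_iff)
qed

section \<open>Affine combinations of PMFs\<close>

lemma sum_affine_combination:
  assumes "input_pmf p" "input_pmf r"
  shows "(\<Sum>i\<in>UNIV. (u *\<^sub>R p + v *\<^sub>R r) $ i) = u + v"
proof -
  have "(\<Sum>i\<in>UNIV. (u *\<^sub>R p + v *\<^sub>R r) $ i)
      = u * (\<Sum>i\<in>UNIV. p $ i) + v * (\<Sum>i\<in>UNIV. r $ i)"
    by (simp add: sum.distrib sum_distrib_left)
  with assms show ?thesis by (simp add: input_pmf_def)
qed

lemma input_pmf_midpoint:
  assumes "input_pmf p" "input_pmf r"
  shows "input_pmf ((1/2) *\<^sub>R p + (1/2) *\<^sub>R r)"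
  using sum_affine_combination[OF assms, of "1/2" "1/2"] assms by (simp add: input_pmf_def)

text \<open>A positive coordinate of \<open>p\<close> stays positive for small \<open>t\<close> of
  either sign, a vanishing one stays 0 by the support condition, and there are only finitely many
  coordinates.\<close>

lemma eventually_input_pmf_on_line:
  fixes p r :: "real ^ 'm::finite"
  assumes p: "input_pmf p" and r: "input_pmf r"
    and supp: "\<And>i. p $ i = 0 \<Longrightarrow> r $ i = 0"
  shows "\<forall>\<^sub>F t in nhds 0. input_pmf ((1 - t) *\<^sub>R p + t *\<^sub>R r)"
proof -
  have "\<forall>\<^sub>F t in nhds 0. 0 \<le> (1 - t) * p $ i + t * r $ i" for i
  proof (cases "p $ i = 0")
    case True
    with supp show ?thesis by simp
  next
    case False
    with p have "0 < p $ i"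
      by (simp add: input_pmf_def order_less_le)
    moreover have "((\<lambda>t. (1 - t) * p $ i + t * r $ i) \<longlongrightarrow> p $ i) (nhds 0)"
      by (auto intro!: tendsto_eq_intros filterlim_ident)
    ultimately have "\<forall>\<^sub>F t in nhds 0. 0 < (1 - t) * p $ i + t * r $ i"
      by (rule order_tendstoD(1)[rotated])
    then show ?thesis by eventually_elim simp
  qed
  then have "\<forall>\<^sub>F t in nhds 0. \<forall>i. 0 \<le> (1 - t) * p $ i + t * r $ i"
    by (rule eventually_all_finite)
  then show ?thesis
  proof eventually_elim
    case (elim t)
    then show ?case
      using sum_affine_combination[OF p r, of "1 - t" t] by (simp add: input_pmf_def)
  qed
qed

text \<open>Translation invariance of Lebesgue measure; it carries facts about the noise over to
  every conditional density.\<close>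

lemma lborel_shift:
  fixes g :: "complex \<Rightarrow> real"
  assumes "integrable lborel g"
  shows integrable_lborel_shift: "integrable lborel (\<lambda>y. g (y - c))"
    and integral_lborel_shift: "(LINT y|lborel. g (y - c)) = (LINT y|lborel. g y)"
proof -
  have g: "g \<in> borel_measurable borel"
    using borel_measurable_integrable[OF assms] by simp
  have d: "distr lborel borel (\<lambda>y. y - c) = lborel"
    using lborel_distr_plus[of "-c"] unfolding uminus_add_conv_diff by simp
  show "integrable lborel (\<lambda>y. g (y - c))"
    using integrable_distr_eq[of "\<lambda>y. y - c" lborel borel g] g assms by (simp add: d)
  show "(LINT y|lborel. g (y - c)) = (LINT y|lborel. g y)"
    using integral_distr[of "\<lambda>y. y - c" lborel borel g] g by (simp add: d)
qed

section \<open>The channel and its output densities\<close>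

text \<open>The last assumption says that the noise has finite differential entropy. It makes the
  integrals in \<open>mutual_info\<close> genuine for every PMF, not the 0 that the Bochner integral
  assigns to a non-integrable function.\<close>

locale noise_channel =
  fixes b :: real and h :: "complex \<Rightarrow> real" and x :: "'m::finite \<Rightarrow> complex"
  assumes base_gt_1: "1 < b"
    and density: "noise_density h"
    and entropy_integrable: "integrable lborel (\<lambda>z. h z * log b (h z))"
begin

lemma ln_base_pos: "0 < ln b"
  using base_gt_1 by simp

lemma h_measurable [measurable]: "h \<in> borel_measurable borel"
  using density by (simp add: noise_density_def)

lemma cond_density_nonneg: "0 \<le> cond_density h x i y"
  using density by (simp add: noise_density_def cond_density_def)

lemma cond_density_measurable [measurable]: "cond_density h x i \<in> borel_measurable borel"
  unfolding cond_density_def[abs_def] by measurable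

lemma cond_density_integrable: "integrable lborel (cond_density h x i)"
  and cond_density_integral: "(LINT y|lborel. cond_density h x i y) = 1"
  using density integrable_lborel_shift[of h "x i"] integral_lborel_shift[of h "x i"]
  by (simp_all add: noise_density_def cond_density_def[abs_def])

lemma cond_density_log_integrable:
  "integrable lborel (\<lambda>y. cond_density h x i y * log b (cond_density h x i y))"
  using integrable_lborel_shift[OF entropy_integrable, of "x i"] by (simp add: cond_density_def)

lemma output_density_measurable [measurable]: "output_density h x p \<in> borel_measurable borel"
  unfolding output_density_def[abs_def] by measurable

lemma output_density_integrable: "integrable lborel (output_density h x p)"
  unfolding output_density_def[abs_def]
  by (intro Bochner_Integration.integrable_sum integrable_mult_right cond_density_integrable)

lemma output_density_integral:
  "input_pmf p \<Longrightarrow> (LINT y|lborel. output_density h x p y) = 1"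
  by (simp add: output_density_def cond_density_integrable cond_density_integral input_pmf_def)

lemma output_density_nonneg: "input_pmf p \<Longrightarrow> 0 \<le> output_density h x p y"
  unfolding output_density_def
  by (intro sum_nonneg mult_nonneg_nonneg cond_density_nonneg) (simp add: input_pmf_def)

lemma output_density_ge_component:
  assumes "input_pmf p"
  shows "p $ i * cond_density h x i y \<le> output_density h x p y"
  unfolding output_density_def
  by (rule member_le_sum) (use assms in \<open>auto simp: input_pmf_def cond_density_nonneg\<close>)

lemma output_density_linear:
  "output_density h x (u *\<^sub>R p + v *\<^sub>R r) y
     = u * output_density h x p y + v * output_density h x r y"
  by (simp add: output_density_def sum_distrib_left sum.distrib algebra_simps)

lemma input_pmf_le_1: "input_pmf p \<Longrightarrow> p $ i \<le> 1"
  using member_le_sum[of i UNIV "\<lambda>i. p $ i"] by (simp add: input_pmf_def)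

section \<open>Finiteness of the output entropy\<close>

text \<open>A single integrable bound for the entropy integrands of all PMFs, as dominated
  convergence requires. The second summand pays for the negative values of
  \<open>p $ i * log b (p $ i)\<close>.\<close>

definition entropy_majorant :: "complex \<Rightarrow> real" where
  "entropy_majorant y = (\<Sum>i\<in>UNIV. \<bar>cond_density h x i y * log b (cond_density h x i y)\<bar>
      + cond_density h x i y / ln b)"

lemma entropy_majorant_integrable: "integrable lborel entropy_majorant"
  unfolding entropy_majorant_def[abs_def]
  by (intro Bochner_Integration.integrable_sum Bochner_Integration.integrable_add integrable_abs
      integrable_divide cond_density_log_integrable cond_density_integrable)

text \<open>The upper bound is Jensen's inequality for \<open>u log u\<close>. For the lower one,
  each summand of the output density is at most the whole, so the logarithm of the whole may be
  replaced by that of the summand, which splits into a part from \<open>p $ i\<close> and a part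
  from the conditional density.\<close>

lemma output_entropy_bound:
  assumes p: "input_pmf p"
  shows "\<bar>output_density h x p y * log b (output_density h x p y)\<bar> \<le> entropy_majorant y"
proof -
  let ?f = "\<lambda>i. cond_density h x i y" and ?q = "output_density h x p y"
  have p01: "0 \<le> p $ i" "p $ i \<le> 1" for i
    using p input_pmf_le_1[OF p] by (auto simp: input_pmf_def)
  have term_le: "\<bar>p $ i * (?f i * log b (?f i))\<bar> \<le> \<bar>?f i * log b (?f i)\<bar>" for i
    using mult_right_mono[of "p $ i" 1 "\<bar>?f i * log b (?f i)\<bar>"] p01[of i]
    by (simp add: abs_mult)
  have frac_nonneg: "0 \<le> ?f i / ln b" for i
    using ln_base_pos cond_density_nonneg by simp
  have "?q * log b ?q \<le> (\<Sum>i\<in>UNIV. p $ i * (?f i * log b (?f i)))"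
    using convex_on_sum[OF _ _ convex_on_xlog[OF base_gt_1], of UNIV "\<lambda>i. p $ i" ?f] p
    by (simp add: output_density_def input_pmf_def cond_density_nonneg)
  also have "\<dots> \<le> entropy_majorant y"
    unfolding entropy_majorant_def
  proof (rule sum_mono)
    show "p $ i * (?f i * log b (?f i)) \<le> \<bar>?f i * log b (?f i)\<bar> + ?f i / ln b" for i
      using term_le[of i] frac_nonneg[of i] by linarith
  qed
  finally have upper: "?q * log b ?q \<le> entropy_majorant y" .
  have "- entropy_majorant y \<le> (\<Sum>i\<in>UNIV. p $ i * ?f i * log b ?q)"
    unfolding entropy_majorant_def sum_negf[symmetric]
  proof (rule sum_mono)
    fix i
    show "- (\<bar>?f i * log b (?f i)\<bar> + ?f i / ln b) \<le> p $ i * ?f i * log b ?q"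
    proof (cases "p $ i * ?f i = 0")
      case True
      with frac_nonneg[of i] show ?thesis
        using abs_ge_zero[of "?f i * log b (?f i)"] by (simp only: mult_zero_left)
    next
      case False
      then have pos: "0 < p $ i" "0 < ?f i"
        using p01[of i] cond_density_nonneg[of i y] by (auto simp: order_less_le)
      have "log b (p $ i * ?f i) \<le> log b ?q"
        using output_density_ge_component[OF p, of i y] pos base_gt_1
        by (intro log_mono) auto
      then have "p $ i * ?f i * log b (p $ i * ?f i) \<le> p $ i * ?f i * log b ?q"
        using pos by (intro mult_left_mono) auto
      moreover have "p $ i * ?f i * log b (p $ i * ?f i)
          = ?f i * (p $ i * log b (p $ i)) + p $ i * (?f i * log b (?f i))"
        using pos base_gt_1 by (simp add: log_mult algebra_simps)
      \<comment> \<open>The tangent of \<open>u log u\<close> at 1 bounds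
        \<open>p $ i * log b (p $ i)\<close> below by \<open>- (1 / ln b)\<close>, uniformly in
        \<open>p\<close>.\<close>
      moreover have "- (?f i / ln b) \<le> ?f i * (p $ i * log b (p $ i))"
      proof -
        have "- (1 / ln b) \<le> (p $ i - 1) / ln b"
          using p01[of i] ln_base_pos by (simp add: field_simps)
        also have "\<dots> \<le> p $ i * log b (p $ i)"
          using xlog_ge_tangent[OF base_gt_1, of "p $ i" 1] p01 by simp
        finally have "?f i * - (1 / ln b) \<le> ?f i * (p $ i * log b (p $ i))"
          using pos by (intro mult_left_mono) auto
        then show ?thesis by simp
      qed
      ultimately show ?thesis
        using term_le[of i] by linarith
    qed
  qed
  also have "\<dots> = ?q * log b ?q"
    by (simp add: output_density_def sum_distrib_right)
  finally show ?thesis using upper by simp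
qed

lemma output_entropy_integrable:
  assumes "input_pmf p"
  shows "integrable lborel (\<lambda>y. output_density h x p y * log b (output_density h x p y))"
proof (rule Bochner_Integration.integrable_bound[OF entropy_majorant_integrable])
  show "AE y in lborel. norm (output_density h x p y * log b (output_density h x p y))
      \<le> norm (entropy_majorant y)"
    using order_trans[OF output_entropy_bound[OF assms] abs_ge_self] by simp
qed measurable

section \<open>Attainment of the capacity and concavity\<close>

text \<open>The second term is linear in \<open>p\<close>. The entropy term is treated along
  sequences, by dominated convergence with \<open>entropy_majorant\<close>.\<close>

lemma continuous_on_mutual_info: "continuous_on {p. input_pmf p} (mutual_info b h x)"
  unfolding mutual_info_def[abs_def]
proof (intro continuous_intros)
  show "continuous_on {p. input_pmf p}
      (\<lambda>p. LINT y|lborel. output_density h x p y * log b (output_density h x p y))"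
    unfolding continuous_on_sequentially comp_def
  proof (intro allI ballI impI)
    fix p and P :: "nat \<Rightarrow> real ^ 'm"
    assume p: "p \<in> {p. input_pmf p}"
      and P: "(\<forall>n. P n \<in> {p. input_pmf p}) \<and> P \<longlonglongrightarrow> p"
    show "(\<lambda>n. LINT y|lborel. output_density h x (P n) y * log b (output_density h x (P n) y))
        \<longlonglongrightarrow> (LINT y|lborel. output_density h x p y * log b (output_density h x p y))"
    proof (rule integral_dominated_convergence[OF _ _ entropy_majorant_integrable])
      show "AE y in lborel.
          (\<lambda>n. output_density h x (P n) y * log b (output_density h x (P n) y))
            \<longlonglongrightarrow> output_density h x p y * log b (output_density h x p y)"
      proof (rule AE_I2)
        fix y
        have "(\<lambda>n. output_density h x (P n) y) \<longlonglongrightarrow> output_density h x p y"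
          unfolding output_density_def using P by (intro tendsto_intros) auto
        then show "(\<lambda>n. output_density h x (P n) y * log b (output_density h x (P n) y))
            \<longlonglongrightarrow> output_density h x p y * log b (output_density h x p y)"
          using p P output_density_nonneg
          by (intro continuous_on_tendsto_compose[OF continuous_on_xlog[OF base_gt_1]]) auto
      qed
    next
      fix n
      show "AE y in lborel. norm (output_density h x (P n) y * log b (output_density h x (P n) y))
          \<le> entropy_majorant y"
        using P output_entropy_bound by simp
    qed measurable
  qed
qed

lemma compact_feasible_pmfs: "compact (feasible_pmfs x E)"
proof -
  have "closed {p :: real ^ 'm. (\<forall>i. 0 \<le> p $ i) \<and> (\<Sum>i\<in>UNIV. p $ i) = 1 \<and> weights x \<bullet> p \<le> E}"
    by (intro closed_Collect_conj closed_Collect_all closed_Collect_le closed_Collect_eq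
        continuous_intros)
  then have "compact (cbox 0 1 \<inter>
      {p :: real ^ 'm. (\<forall>i. 0 \<le> p $ i) \<and> (\<Sum>i\<in>UNIV. p $ i) = 1 \<and> weights x \<bullet> p \<le> E})"
    by (intro compact_Int_closed compact_cbox)
  moreover have "feasible_pmfs x E = cbox 0 1 \<inter>
      {p :: real ^ 'm. (\<forall>i. 0 \<le> p $ i) \<and> (\<Sum>i\<in>UNIV. p $ i) = 1 \<and> weights x \<bullet> p \<le> E}"
    unfolding feasible_pmfs_def using input_pmf_le_1
    by (fastforce simp: mem_box_cart input_pmf_def)
  ultimately show ?thesis by simp
qed

text \<open>A continuous function attains its maximum on a compact set, so the
  \<open>GREATEST\<close> in \<open>capacity\<close> denotes an actual maximum.\<close>

lemma capacity_attained:
  assumes "feasible_pmfs x E \<noteq> {}"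
  obtains p where "p \<in> feasible_pmfs x E" "capacity b h x E = mutual_info b h x p"
    and "\<And>r. r \<in> feasible_pmfs x E \<Longrightarrow> mutual_info b h x r \<le> capacity b h x E"
proof -
  have "continuous_on (feasible_pmfs x E) (mutual_info b h x)"
    by (rule continuous_on_subset[OF continuous_on_mutual_info]) (auto simp: feasible_pmfs_def)
  then obtain p where p: "p \<in> feasible_pmfs x E"
      "\<And>r. r \<in> feasible_pmfs x E \<Longrightarrow> mutual_info b h x r \<le> mutual_info b h x p"
    using continuous_attains_sup[OF compact_feasible_pmfs assms] by metis
  then have "capacity b h x E = mutual_info b h x p"
    unfolding capacity_def by (intro Greatest_equality) auto
  with p show ?thesis by (intro that) auto
qed

text \<open>The output density and the second term of \<open>mutual_info\<close> are linear in the
  PMF, so only the convexity of \<open>u log u\<close> has to be integrated. Midpoints serve to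
  compare the energies \<open>E + s\<close> and \<open>E - s\<close> with \<open>E\<close>.\<close>

lemma mutual_info_midpoint_concave:
  assumes p: "input_pmf p" and r: "input_pmf r"
  shows "mutual_info b h x p + mutual_info b h x r
    \<le> 2 * mutual_info b h x ((1/2) *\<^sub>R p + (1/2) *\<^sub>R r)"
proof -
  let ?m = "(1/2) *\<^sub>R p + (1/2) *\<^sub>R r"
  let ?\<phi> = "\<lambda>p y. output_density h x p y * log b (output_density h x p y)"
  have "2 * (LINT y|lborel. ?\<phi> ?m y) = (LINT y|lborel. 2 * ?\<phi> ?m y)"
    by simp
  also have "\<dots> \<le> (LINT y|lborel. ?\<phi> p y + ?\<phi> r y)"
  proof (rule integral_mono)
    fix y
    show "2 * ?\<phi> ?m y \<le> ?\<phi> p y + ?\<phi> r y"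
      using convex_onD[OF convex_on_xlog[OF base_gt_1], of "1/2" "output_density h x p y"
          "output_density h x r y"] output_density_nonneg[OF p] output_density_nonneg[OF r]
      unfolding output_density_linear by simp
  qed (intro integrable_mult_right Bochner_Integration.integrable_add output_entropy_integrable
      input_pmf_midpoint[OF p r] p r)+
  also have "\<dots> = (LINT y|lborel. ?\<phi> p y) + (LINT y|lborel. ?\<phi> r y)"
    by (intro Bochner_Integration.integral_add output_entropy_integrable p r)
  finally show ?thesis
    unfolding mutual_info_def
    by (simp add: sum.distrib sum_distrib_left algebra_simps)
qed

section \<open>Cross entropies and the divergence\<close>

text \<open>The conditional density is at most the output density divided by \<open>p $ i\<close>,
  so the entropy integrand divided by \<open>p $ i\<close> is a majorant.\<close>

lemma cross_term_integrable:
  assumes p: "input_pmf p" and i: "p $ i \<noteq> 0"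
  shows "integrable lborel (\<lambda>y. cond_density h x i y * log b (output_density h x p y))"
proof (rule Bochner_Integration.integrable_bound)
  show "integrable lborel
      (\<lambda>y. (output_density h x p y * log b (output_density h x p y)) / p $ i)"
    by (intro integrable_divide output_entropy_integrable p)
  show "AE y in lborel. norm (cond_density h x i y * log b (output_density h x p y))
      \<le> norm (output_density h x p y * log b (output_density h x p y) / p $ i)"
  proof (rule AE_I2)
    fix y
    have pi: "0 < p $ i"
      using p i by (simp add: input_pmf_def order_less_le)
    have "cond_density h x i y \<le> output_density h x p y / p $ i"
      using output_density_ge_component[OF p, of i y] pi by (simp add: field_simps)
    then have "cond_density h x i y * \<bar>log b (output_density h x p y)\<bar>
        \<le> output_density h x p y / p $ i * \<bar>log b (output_density h x p y)\<bar>"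
      by (intro mult_right_mono) auto
    then show "norm (cond_density h x i y * log b (output_density h x p y))
        \<le> norm (output_density h x p y * log b (output_density h x p y) / p $ i)"
      using pi cond_density_nonneg[of i y] output_density_nonneg[OF p, of y]
      by (simp add: abs_mult)
  qed
qed measurable

lemma cross_entropy:
  assumes p: "input_pmf p" and supp: "\<And>i. p $ i = 0 \<Longrightarrow> r $ i = 0"
  shows cross_entropy_integrable:
      "integrable lborel (\<lambda>y. output_density h x r y * log b (output_density h x p y))"
    and cross_entropy_integral:
      "(LINT y|lborel. output_density h x r y * log b (output_density h x p y))
        = (\<Sum>i\<in>UNIV. r $ i *
            (LINT y|lborel. cond_density h x i y * log b (output_density h x p y)))"
proof -
  have eq: "output_density h x r y * log b (output_density h x p y)
      = (\<Sum>i\<in>UNIV. r $ i * (cond_density h x i y * log b (output_density h x p y)))" for y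
    by (simp add: output_density_def[of h x r] sum_distrib_right mult.assoc)
  have int: "integrable lborel
      (\<lambda>y. r $ i * (cond_density h x i y * log b (output_density h x p y)))" for i
  \<comment> \<open>If \<open>p $ i = 0\<close>, the factor \<open>r $ i\<close> is 0 and the
    integrand vanishes identically.\<close>
  proof (cases "p $ i = 0")
    case True
    then show ?thesis by (simp add: supp)
  next
    case False
    then show ?thesis by (intro integrable_mult_right cross_term_integrable p)
  qed
  show "integrable lborel (\<lambda>y. output_density h x r y * log b (output_density h x p y))"
    unfolding eq by (intro Bochner_Integration.integrable_sum int)
  show "(LINT y|lborel. output_density h x r y * log b (output_density h x p y))
      = (\<Sum>i\<in>UNIV. r $ i *
          (LINT y|lborel. cond_density h x i y * log b (output_density h x p y)))"
    unfolding eq by (subst Bochner_Integration.integral_sum, rule int) simp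
qed

text \<open>Summandwise, write \<open>r $ i\<close> as \<open>r $ i / p $ i * p $ i\<close>; where
  \<open>p $ i = 0\<close> both sides vanish. Hence the ratio of the output densities is bounded,
  and a zero of the one for \<open>p\<close> is a zero of the one for \<open>r\<close>.\<close>

lemma output_density_dominated:
  assumes p: "input_pmf p" and r: "input_pmf r"
    and supp: "\<And>i. p $ i = 0 \<Longrightarrow> r $ i = 0"
  shows "output_density h x r y \<le> (\<Sum>i\<in>UNIV. r $ i / p $ i) * output_density h x p y"
  unfolding output_density_def[of h x r] sum_distrib_right
proof (rule sum_mono)
  fix i
  show "r $ i * cond_density h x i y \<le> r $ i / p $ i * output_density h x p y"
  proof (cases "p $ i = 0")
    case True
    with supp show ?thesis by simp
  next
    case False
    have "0 \<le> r $ i / p $ i"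
      using p r by (simp add: input_pmf_def)
    then have "r $ i / p $ i * (p $ i * cond_density h x i y)
        \<le> r $ i / p $ i * output_density h x p y"
      using output_density_ge_component[OF p] by (intro mult_left_mono)
    with False show ?thesis by simp
  qed
qed

text \<open>The quotient rule for \<open>log\<close> needs positive arguments: domination supplies
  them where the density for \<open>r\<close> is positive, and elsewhere both sides are 0.\<close>

lemma output_log_ratio:
  assumes p: "input_pmf p" and r: "input_pmf r"
    and supp: "\<And>i. p $ i = 0 \<Longrightarrow> r $ i = 0"
  shows "output_density h x r y * log b (output_density h x r y / output_density h x p y)
    = output_density h x r y * log b (output_density h x r y)
      - output_density h x r y * log b (output_density h x p y)"
proof (cases "output_density h x r y = 0")
  case False
  then have "0 < output_density h x r y"
    using output_density_nonneg[OF r] by (simp add: order_less_le)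
  moreover from this have "output_density h x p y \<noteq> 0"
    using output_density_dominated[OF p r supp, of y] by auto
  then have "0 < output_density h x p y"
    using output_density_nonneg[OF p, of y] by linarith
  ultimately show ?thesis
    by (simp add: log_divide right_diff_distrib)
qed simp

text \<open>
  Where \<open>p\<close> vanishes, the second integral need not exist; this is harmless because \<open>linear_info p r\<close>
  is only used for \<open>r\<close> that vanish there as well.
\<close>

definition linear_info :: "real ^ 'm \<Rightarrow> real ^ 'm \<Rightarrow> real" where
  "linear_info p r = (\<Sum>i\<in>UNIV. r $ i *
     ((LINT y|lborel. cond_density h x i y * log b (cond_density h x i y))
      - (LINT y|lborel. cond_density h x i y * log b (output_density h x p y))))"

lemma linear_info_affine:
  "linear_info p (u *\<^sub>R r + v *\<^sub>R r') = u * linear_info p r + v * linear_info p r'"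
  by (simp add: linear_info_def sum_distrib_left sum.distrib distrib_right mult.assoc)

lemma linear_info_self:
  assumes "input_pmf p"
  shows "linear_info p p = mutual_info b h x p"
  unfolding linear_info_def mutual_info_def
  by (subst cross_entropy_integral[OF assms])
     (simp_all add: right_diff_distrib sum_subtractf)

text \<open>The divergence is the cross entropy minus the entropy of the output for
  \<open>r\<close>, and \<open>linear_info\<close> contains the same cross entropy, which
  cancels.\<close>

lemma mutual_info_eq_linear_minus_kl:
  assumes p: "input_pmf p" and r: "input_pmf r"
    and supp: "\<And>i. p $ i = 0 \<Longrightarrow> r $ i = 0"
  shows "mutual_info b h x r
    = linear_info p r - kl_dist b (output_density h x r) (output_density h x p)"
proof -
  have ratio: "output_density h x r y * log b (output_density h x r y / output_density h x p y)
      = output_density h x r y * log b (output_density h x r y)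
        - output_density h x r y * log b (output_density h x p y)" for y
    by (rule output_log_ratio[OF p r supp])
  have "kl_dist b (output_density h x r) (output_density h x p)
      = (LINT y|lborel. output_density h x r y * log b (output_density h x r y))
        - (LINT y|lborel. output_density h x r y * log b (output_density h x p y))"
    unfolding kl_dist_def ratio
    by (intro Bochner_Integration.integral_diff output_entropy_integrable[OF r]
        cross_entropy_integrable[OF p supp])
  moreover have "(LINT y|lborel. output_density h x r y * log b (output_density h x p y))
      = (\<Sum>i\<in>UNIV. r $ i *
          (LINT y|lborel. cond_density h x i y * log b (output_density h x p y)))"
    by (rule cross_entropy_integral[OF p supp])
  ultimately show ?thesis
    unfolding linear_info_def mutual_info_def
    by (simp add: right_diff_distrib sum_subtractf)
qed

text \<open>The divergence is at most the chi-square distance of the output densities divided by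
  \<open>ln b\<close>, and the latter is quadratic in \<open>t\<close>.\<close>

lemma kl_dist_on_line_le:
  fixes t :: real
  defines "s \<equiv> \<lambda>p r. (1 - t) *\<^sub>R p + t *\<^sub>R (r :: real ^ 'm)"
  assumes p: "input_pmf p" and r: "input_pmf r"
    and supp: "\<And>i. p $ i = 0 \<Longrightarrow> r $ i = 0"
    and s: "input_pmf (s p r)"
  shows "kl_dist b (output_density h x (s p r)) (output_density h x p)
    \<le> (1 + (\<Sum>i\<in>UNIV. r $ i / p $ i))\<^sup>2 / ln b * t\<^sup>2"
proof -
  \<comment> \<open>Domination bounds the difference of the output densities for \<open>r\<close>
    and \<open>p\<close> by \<open>K * ?q y\<close> in absolute value; the added 1 covers the case
    where the density for \<open>r\<close> is the smaller one.\<close>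
  define K where "K = 1 + (\<Sum>i\<in>UNIV. r $ i / p $ i)"
  let ?q = "output_density h x p" and ?qs = "output_density h x (s p r)"
  have supp_s: "s p r $ i = 0" if "p $ i = 0" for i
    using that supp by (simp add: s_def)
  have ratio: "?qs y * log b (?qs y / ?q y) = ?qs y * log b (?qs y) - ?qs y * log b (?q y)" for y
    by (rule output_log_ratio[OF p s supp_s])
  have K: "1 \<le> K"
    unfolding K_def using p r by (auto simp: input_pmf_def intro!: sum_nonneg)
  have "kl_dist b ?qs ?q \<le> (LINT y|lborel. (?qs y - ?q y + t\<^sup>2 * K\<^sup>2 * ?q y) / ln b)"
    unfolding kl_dist_def
  proof (rule integral_mono)
    show "integrable lborel (\<lambda>y. ?qs y * log b (?qs y / ?q y))"
      unfolding ratio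
      by (intro Bochner_Integration.integrable_diff output_entropy_integrable[OF s]
          cross_entropy_integrable[OF p supp_s])
    show "integrable lborel (\<lambda>y. (?qs y - ?q y + t\<^sup>2 * K\<^sup>2 * ?q y) / ln b)"
      by (intro integrable_divide Bochner_Integration.integrable_add integrable_mult_right
          Bochner_Integration.integrable_diff output_density_integrable)
    fix y
    have q: "0 \<le> ?q y" and qs: "0 \<le> ?qs y"
      using output_density_nonneg p s by auto
    have diff: "?qs y - ?q y = t * (output_density h x r y - ?q y)"
      unfolding s_def output_density_linear by (simp add: algebra_simps)
    have "\<bar>output_density h x r y - ?q y\<bar> \<le> K * ?q y"
      using output_density_dominated[OF p r supp, of y] output_density_nonneg[OF r, of y] q
        mult_right_mono[OF K q]
      unfolding K_def by (simp add: distrib_right)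
    then have "\<bar>output_density h x r y - ?q y\<bar>\<^sup>2 \<le> (K * ?q y)\<^sup>2"
      by (intro power_mono) auto
    then have "t\<^sup>2 * (output_density h x r y - ?q y)\<^sup>2 \<le> t\<^sup>2 * (K * ?q y)\<^sup>2"
      by (intro mult_left_mono) auto
    then have sq: "(?qs y - ?q y)\<^sup>2 \<le> t\<^sup>2 * K\<^sup>2 * ?q y * ?q y"
      unfolding diff power_mult_distrib by (simp add: power2_eq_square mult.assoc)
    have "?qs y * ln (?qs y / ?q y) \<le> ?qs y - ?q y + t\<^sup>2 * K\<^sup>2 * ?q y"
    proof (cases "?q y = 0")
      \<comment> \<open>Here \<open>sq\<close> forces \<open>?qs y = 0\<close>.\<close>
      case True
      with sq show ?thesis by simp
    next
      case False
      with q have qpos: "0 < ?q y" by simp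
      have "?qs y * ln (?qs y / ?q y) \<le> ?qs y * (?qs y / ?q y - 1)"
      proof (cases "?qs y = 0")
        case False
        with qs qpos have "0 < ?qs y / ?q y" by simp
        then show ?thesis
          using qs by (intro mult_left_mono ln_le_minus_one)
      qed simp
      \<comment> \<open>This splits off the chi-square integrand from a difference of
        densities.\<close>
      also have "\<dots> = ?qs y - ?q y + (?qs y - ?q y)\<^sup>2 / ?q y"
        using qpos by (simp add: field_simps power2_eq_square)
      also have "(?qs y - ?q y)\<^sup>2 / ?q y \<le> t\<^sup>2 * K\<^sup>2 * ?q y"
        using sq qpos by (simp add: pos_divide_le_eq)
      finally show ?thesis by simp
    qed
    then have "?qs y * ln (?qs y / ?q y) / ln b \<le> (?qs y - ?q y + t\<^sup>2 * K\<^sup>2 * ?q y) / ln b"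
      using ln_base_pos by (intro divide_right_mono) auto
    then show "?qs y * log b (?qs y / ?q y) \<le> (?qs y - ?q y + t\<^sup>2 * K\<^sup>2 * ?q y) / ln b"
      by (simp add: log_def)
  qed
  \<comment> \<open>Both output densities have integral 1, so the first-order difference drops
    out.\<close>
  also have "\<dots> = K\<^sup>2 / ln b * t\<^sup>2"
    by (simp add: output_density_integrable output_density_integral p s)
  finally show ?thesis unfolding K_def .
qed

section \<open>Mutual information and capacity along a line\<close>

text \<open>On the line \<open>linear_info\<close> is affine in \<open>t\<close>, and the divergence
  is at most quadratic with a constant independent of \<open>t\<close>.\<close>

lemma mutual_info_on_line_ge:
  assumes p: "input_pmf p" and r: "input_pmf r"
    and supp: "\<And>i. p $ i = 0 \<Longrightarrow> r $ i = 0"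
  obtains M where "\<And>t. input_pmf ((1 - t) *\<^sub>R p + t *\<^sub>R r) \<Longrightarrow>
    mutual_info b h x p + t * (linear_info p r - mutual_info b h x p) - M * t\<^sup>2
      \<le> mutual_info b h x ((1 - t) *\<^sub>R p + t *\<^sub>R r)"
proof
  fix t :: real
  let ?s = "(1 - t) *\<^sub>R p + t *\<^sub>R r"
  assume s: "input_pmf ?s"
  have "mutual_info b h x ?s
      = linear_info p ?s - kl_dist b (output_density h x ?s) (output_density h x p)"
    using supp by (intro mutual_info_eq_linear_minus_kl p s) simp
  moreover have "linear_info p ?s
      = mutual_info b h x p + t * (linear_info p r - mutual_info b h x p)"
    unfolding linear_info_affine linear_info_self[OF p] by (simp add: algebra_simps)
  ultimately show "mutual_info b h x p + t * (linear_info p r - mutual_info b h x p)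
        - (1 + (\<Sum>i\<in>UNIV. r $ i / p $ i))\<^sup>2 / ln b * t\<^sup>2
      \<le> mutual_info b h x ?s"
    using kl_dist_on_line_le[OF p r supp s] by simp
qed

lemma weights_on_line:
  "weights x \<bullet> ((1 - t) *\<^sub>R p + t *\<^sub>R r)
     = weights x \<bullet> p + t * (weights x \<bullet> r - weights x \<bullet> p)"
  by (simp add: algebra_simps)

lemma linear_info_eq_of_equal_weights:
  assumes ca: "capacity_achieving b h x p" and r: "input_pmf r"
    and supp: "\<And>i. p $ i = 0 \<Longrightarrow> r $ i = 0"
    and weights: "weights x \<bullet> r = weights x \<bullet> p"
  shows "linear_info p r = mutual_info b h x p"
proof -
  let ?J = "linear_info p r - mutual_info b h x p"
  have p: "input_pmf p"
    using ca by (simp add: capacity_achieving_def)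
  obtain M where M: "\<And>t. input_pmf ((1 - t) *\<^sub>R p + t *\<^sub>R r) \<Longrightarrow>
      mutual_info b h x p + t * ?J - M * t\<^sup>2 \<le> mutual_info b h x ((1 - t) *\<^sub>R p + t *\<^sub>R r)"
    using mutual_info_on_line_ge[OF p r supp] by blast
  have "t * ?J \<le> M * t\<^sup>2" if "input_pmf ((1 - t) *\<^sub>R p + t *\<^sub>R r)" for t
  proof -
    have "(1 - t) *\<^sub>R p + t *\<^sub>R r \<in> feasible_pmfs x (weights x \<bullet> p)"
      using that by (simp add: feasible_pmfs_def weights_on_line weights)
    with ca have "mutual_info b h x ((1 - t) *\<^sub>R p + t *\<^sub>R r) \<le> mutual_info b h x p"
      by (simp add: capacity_achieving_def)
    with M[OF that] show ?thesis by linarith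
  qed
  then have ev: "\<forall>\<^sub>F t in nhds 0. t * ?J \<le> M * t\<^sup>2"
    using eventually_input_pmf_on_line[OF p r supp] by (auto elim: eventually_mono)
  have "\<forall>\<^sub>F t in nhds 0. (- t) * ?J \<le> M * (- t)\<^sup>2"
    by (rule eventually_compose_filterlim[OF ev]) (auto intro!: tendsto_eq_intros filterlim_ident)
  \<comment> \<open>The inequalities at \<open>t\<close> and \<open>- t\<close> bound
    \<open>t * ?J\<close> in absolute value. Read as a quadratic bound for the zero function, this
    makes \<open>?J\<close> its derivative, hence 0.\<close>
  with ev have "\<forall>\<^sub>F t in nhds 0. \<bar>0 - 0 - t * ?J\<bar> \<le> M * t\<^sup>2"
    by eventually_elim (simp add: abs_le_iff)
  then have "((\<lambda>_. 0) has_real_derivative ?J) (at 0)"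
    by (rule has_real_derivative_of_quadratic_bound)
  then show ?thesis
    using DERIV_unique[OF _ DERIV_const] by fastforce
qed

lemma capacity_has_derivative:
  assumes ca: "capacity_achieving b h x p" and r: "input_pmf r"
    and supp: "\<And>i. p $ i = 0 \<Longrightarrow> r $ i = 0"
    and weights: "weights x \<bullet> r \<noteq> weights x \<bullet> p"
  shows "(capacity b h x has_real_derivative
    (linear_info p r - mutual_info b h x p) / (weights x \<bullet> r - weights x \<bullet> p))
      (at (weights x \<bullet> p))"
proof -
  define E where "E = weights x \<bullet> p"
  define d where "d = weights x \<bullet> r - E"
  let ?J = "linear_info p r - mutual_info b h x p"
  let ?C = "capacity b h x"
  have d: "d \<noteq> 0"
    using weights by (simp add: d_def E_def)
  have p: "input_pmf p"
    using ca by (simp add: capacity_achieving_def)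
  have CE: "?C E = mutual_info b h x p"
    unfolding E_def by (rule capacity_achieving_imp_capacity_eq[OF ca])
  obtain M where M: "\<And>t. input_pmf ((1 - t) *\<^sub>R p + t *\<^sub>R r) \<Longrightarrow>
      mutual_info b h x p + t * ?J - M * t\<^sup>2 \<le> mutual_info b h x ((1 - t) *\<^sub>R p + t *\<^sub>R r)"
    using mutual_info_on_line_ge[OF p r supp] by blast
  \<comment> \<open>The line is parametrised by the energy increment \<open>s = t * d\<close>, so
    its point has energy exactly \<open>E + s\<close>.\<close>
  define good where
    "good s \<longleftrightarrow> input_pmf ((1 - s / d) *\<^sub>R p + (s / d) *\<^sub>R r)" for s
  have feasible: "(1 - s / d) *\<^sub>R p + (s / d) *\<^sub>R r \<in> feasible_pmfs x (E + s)"
    if "good s" for s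
    using that d by (simp add: good_def feasible_pmfs_def weights_on_line d_def E_def)
  have lower: "?C E + s * (?J / d) - M / d\<^sup>2 * s\<^sup>2 \<le> ?C (E + s)" if s: "good s" for s
  proof -
    have "mutual_info b h x ((1 - s / d) *\<^sub>R p + (s / d) *\<^sub>R r) \<le> ?C (E + s)"
      using capacity_attained[of "E + s"] feasible[OF s] by blast
    with M[OF s[unfolded good_def]] show ?thesis
      by (simp add: CE power_divide mult.commute)
  qed
  \<comment> \<open>The midpoint of maximisers for \<open>E + s\<close> and \<open>E - s\<close> is
    feasible for \<open>E\<close>.\<close>
  have concave: "?C (E + s) + ?C (E - s) \<le> 2 * ?C E" if s: "good s" "good (- s)" for s
  proof -
    obtain p1 where p1: "p1 \<in> feasible_pmfs x (E + s)" "?C (E + s) = mutual_info b h x p1"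
      using capacity_attained[of "E + s"] feasible[OF s(1)] by blast
    obtain p2 where p2: "p2 \<in> feasible_pmfs x (E - s)" "?C (E - s) = mutual_info b h x p2"
      using capacity_attained[of "E - s"] feasible[OF s(2)] by auto
    let ?m = "(1/2) *\<^sub>R p1 + (1/2) *\<^sub>R p2"
    have pmf: "input_pmf p1" "input_pmf p2"
      using p1 p2 by (auto simp: feasible_pmfs_def)
    have "?m \<in> feasible_pmfs x E"
      using p1 p2 input_pmf_midpoint[OF pmf] by (simp add: feasible_pmfs_def inner_add_right)
    then have "mutual_info b h x ?m \<le> ?C E"
      using ca by (simp add: capacity_achieving_def E_def[symmetric] CE)
    with mutual_info_midpoint_concave[OF pmf] p1 p2 show ?thesis by simp
  qed
  have "\<forall>\<^sub>F s in nhds 0. good s"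
    unfolding good_def
    by (rule eventually_compose_filterlim[OF eventually_input_pmf_on_line[OF p r supp]])
       (use d in \<open>auto intro!: tendsto_eq_intros filterlim_ident\<close>)
  moreover from this have "\<forall>\<^sub>F s in nhds 0. good (- s)"
    by (rule eventually_compose_filterlim) (auto intro!: tendsto_eq_intros filterlim_ident)
  \<comment> \<open>The lower bound at \<open>- s\<close>, inserted into \<open>concave\<close>, is
    an upper bound at \<open>s\<close> with the same slope and the same quadratic error.\<close>
  ultimately have "\<forall>\<^sub>F s in nhds 0. \<bar>?C (E + s) - ?C E - s * (?J / d)\<bar> \<le> M / d\<^sup>2 * s\<^sup>2"
  proof eventually_elim
    case (elim s)
    then show ?case
      using lower[of s] lower[of "- s"] concave[of s] by (simp add: abs_le_iff)
  qed
  then have "(?C has_real_derivative ?J / d) (at E)"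
    by (rule has_real_derivative_of_quadratic_bound)
  then show ?thesis by (simp add: d_def E_def)
qed

end

theorem proposition1:
  fixes b :: real
    and h :: "complex \<Rightarrow> real"
    and x :: "'m::finite \<Rightarrow> complex"
    and p_star p_tilde :: "real ^ 'm"
  assumes "1 < b"
    and "inj x"
    and "noise_density h"
    and "integrable lborel (\<lambda>z. h z * log b (h z))"
    and "capacity_achieving b h x p_star"
    and "input_pmf p_tilde"
    and "\<And>i. p_star $ i = 0 \<Longrightarrow> p_tilde $ i = 0"
    and "E_star = weights x \<bullet> p_star" and "I_star = mutual_info b h x p_star"
    and "E_tilde = weights x \<bullet> p_tilde" and "I_tilde = mutual_info b h x p_tilde"
  shows "(E_tilde \<noteq> E_star \<longrightarrow> capacity b h x field_differentiable at E_star) \<and>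
    I_tilde = I_star + deriv (capacity b h x) E_star * (E_tilde - E_star)
      - kl_dist b (output_density h x p_tilde) (output_density h x p_star)"
proof -
  interpret noise_channel b h x
    by unfold_locales (fact assms)+
  have p: "input_pmf p_star"
    using assms(5) by (simp add: capacity_achieving_def)
  have slope: "linear_info p_star p_tilde - I_star
      = deriv (capacity b h x) E_star * (E_tilde - E_star)"
  proof (cases "E_tilde = E_star")
    \<comment> \<open>The slope term is multiplied by 0, whatever value \<open>deriv\<close> takes,
      so the linear part alone has to equal \<open>I_star\<close>.\<close>
    case True
    with assms show ?thesis
      using linear_info_eq_of_equal_weights[of p_star p_tilde] by simp
  next
    case False
    with assms show ?thesis
      using DERIV_imp_deriv[OF capacity_has_derivative[of p_star p_tilde]] by simp
  qed
  have "capacity b h x field_differentiable at E_star" if "E_tilde \<noteq> E_star"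
    using capacity_has_derivative[of p_star p_tilde] assms that
    unfolding field_differentiable_def by blast
  moreover have "I_tilde = linear_info p_star p_tilde
      - kl_dist b (output_density h x p_tilde) (output_density h x p_star)"
    using mutual_info_eq_linear_minus_kl[OF p assms(6,7)] assms(11) by simp
  ultimately show ?thesis using slope by simp
qed

end
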